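(* Let $(X,d,A)$ be a metric pair with $A\neq\emptyset$ and let $0\le p\le\infty$. Then the set $\hat{\mathcal{M}}_p^+(X,A)$ of locally $p$-finite relative Radon measures, with addition of measures and the action $a\cdot\mu=a\mu$ of $\mathbb{R}^+=[0,\infty)$, is a zero-sum-free Riesz cone.
   Context: A metric pair $(X,d,A)$ is a metric space $(X,d)$ with a closed subset $A\subset X$; $d_A(x)=\inf_{a\in A}d(x,a)$. Measures take values in $[0,\infty]$. Let $\mathcal{B}^+(X)$ be the commutative monoid of Borel measures on $X$ and $\mathcal{B}^+(X,A)=\mathcal{B}^+(X)/\mathcal{B}^+(A)$ the quotient monoid: $\mu\sim\nu$ iff $\mu+\sigma=\nu+\tau$ for some Borel measures $\sigma,\tau$ concentrated on $A$; equivalently $\mu,\nu$ agree on Borel subsets of $X\setminus A$, so relative Borel measures correspond bijectively to Borel measures on $X\setminus A$. $\mu\in\mathcal{B}^+(X,A)$ is tight if $\mu(E)=\sup\{\mu(K): K\subset E \text{ compact}\}$ for every Borel $E\subset X\setminus A$. For $p<\infty$, $\mu$ is $p$-finite if $\int_{X\setminus A}d_A^p\,d\mu<\infty$ (for $p=0$: $\mu(X\setminus A)<\infty$); $\mu$ is $\infty$-finite if $\mu(\{d_A>\varepsilon\})<\infty$ for all $\varepsilon>0$ and $\mu(\{d_A>\delta\})=0$ for some $\delta>0$. $\mu$ is locally $p$-finite if each $x\in X$ (including $x\in A$) has a neighborhood $U$ such that $\mu_U$, $\mu_U(E)=\mu(E\cap U)$, is $p$-finite. $\hat{\mathcal{M}}_p^+(X,A)$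 is the set of tight, locally $p$-finite $\mu\in\mathcal{B}^+(X,A)$. A convex cone is a commutative monoid $(C,+,0)$ with an operation $\mathbb{R}^+\times C\to C$ satisfying $\alpha(x+y)=\alpha x+\alpha y$, $(\alpha+\beta)x=\alpha x+\beta x$, $(\alpha\beta)x=\alpha(\beta x)$, $1x=x$, $0x=0$. It is cancellative if $x+z=y+z$ implies $x=y$, and zero-sum-free if $x+y=0$ implies $x=y=0$. Its natural preorder is $x\le y$ iff $x+z=y$ for some $z\in C$. An ordered convex cone is a convex cone with a partial order such that $x\le y$, $w\le z$, $\alpha\ge0$ imply $x+w\le y+z$ and $\alpha x\le\alpha y$. A lattice cone is an ordered convex cone in which every pair $x,y$ has a supremum $x\vee y$ and $(x\vee y)+z=(x+z)\vee(y+z)$ for all $x,y,z$. A Riesz cone is a cancellative convex cone that is a lattice cone with respect to the natural partial order. *)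

theory Defs
  imports "HOL-Analysis.Analysis"
begin

section \<open>Convex cones\<close>

text \<open>Cones are structures on a carrier set \<open>C\<close>. The scalars are the nonnegative reals. (The
  library constant \<^const>\<open>convex_cone\<close> is the unrelated notion of a cone inside a vector space.)\<close>

locale abstract_convex_cone =
  fixes C :: "'c set"
    and add :: "'c \<Rightarrow> 'c \<Rightarrow> 'c"
    and zero :: "'c"
    and smul :: "real \<Rightarrow> 'c \<Rightarrow> 'c"
  assumes add_closed: "x \<in> C \<Longrightarrow> y \<in> C \<Longrightarrow> add x y \<in> C"
    and zero_closed: "zero \<in> C"
    and scale_closed: "0 \<le> a \<Longrightarrow> x \<in> C \<Longrightarrow> smul a x \<in> C"
    and add_assoc: "x \<in> C \<Longrightarrow> y \<in> C \<Longrightarrow> z \<in> C \<Longrightarrow> add (add x y) z = add x (add y z)"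
    and add_comm: "x \<in> C \<Longrightarrow> y \<in> C \<Longrightarrow> add x y = add y x"
    and add_zero: "x \<in> C \<Longrightarrow> add x zero = x"
    and scale_add_right:
      "0 \<le> a \<Longrightarrow> x \<in> C \<Longrightarrow> y \<in> C \<Longrightarrow> smul a (add x y) = add (smul a x) (smul a y)"
    and scale_add_left:
      "0 \<le> a \<Longrightarrow> 0 \<le> b \<Longrightarrow> x \<in> C \<Longrightarrow> smul (a + b) x = add (smul a x) (smul b x)"
    and scale_scale: "0 \<le> a \<Longrightarrow> 0 \<le> b \<Longrightarrow> x \<in> C \<Longrightarrow> smul (a * b) x = smul a (smul b x)"
    and scale_one: "x \<in> C \<Longrightarrow> smul 1 x = x"
    and scale_zero: "x \<in> C \<Longrightarrow> smul 0 x = zero"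

definition cancellative_on :: "'c set \<Rightarrow> ('c \<Rightarrow> 'c \<Rightarrow> 'c) \<Rightarrow> bool" where
  "cancellative_on C add \<longleftrightarrow> (\<forall>x\<in>C. \<forall>y\<in>C. \<forall>z\<in>C. add x z = add y z \<longrightarrow> x = y)"

definition zero_sum_free_on :: "'c set \<Rightarrow> ('c \<Rightarrow> 'c \<Rightarrow> 'c) \<Rightarrow> 'c \<Rightarrow> bool" where
  "zero_sum_free_on C add zero \<longleftrightarrow> (\<forall>x\<in>C. \<forall>y\<in>C. add x y = zero \<longrightarrow> x = zero \<and> y = zero)"

definition natural_le :: "'c set \<Rightarrow> ('c \<Rightarrow> 'c \<Rightarrow> 'c) \<Rightarrow> 'c \<Rightarrow> 'c \<Rightarrow> bool" where
  "natural_le C add x y \<longleftrightarrow> (\<exists>z\<in>C. add x z = y)"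

locale ordered_convex_cone = abstract_convex_cone C add zero smul
  for C :: "'c set" and add zero smul +
  fixes le :: "'c \<Rightarrow> 'c \<Rightarrow> bool"
  assumes partial_order: "partial_order_on C {(x, y). x \<in> C \<and> y \<in> C \<and> le x y}"
    and add_mono:
      "x \<in> C \<Longrightarrow> y \<in> C \<Longrightarrow> w \<in> C \<Longrightarrow> z \<in> C \<Longrightarrow> le x y \<Longrightarrow> le w z \<Longrightarrow> le (add x w) (add y z)"
    and scale_mono:
      "x \<in> C \<Longrightarrow> y \<in> C \<Longrightarrow> 0 \<le> a \<Longrightarrow> le x y \<Longrightarrow> le (smul a x) (smul a y)"

definition is_join :: "'c set \<Rightarrow> ('c \<Rightarrow> 'c \<Rightarrow> bool) \<Rightarrow> 'c \<Rightarrow> 'c \<Rightarrow> 'c \<Rightarrow> bool" where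
  "is_join C le x y s \<longleftrightarrow>
     s \<in> C \<and> le x s \<and> le y s \<and> (\<forall>u\<in>C. le x u \<and> le y u \<longrightarrow> le s u)"

text \<open>Joins are unique by antisymmetry, so \<open>join_add\<close> is
  \<open>(x \<squnion> y) + z = (x + z) \<squnion> (y + z)\<close>.\<close>

locale lattice_cone = ordered_convex_cone C add zero smul le
  for C :: "'c set" and add zero smul le +
  assumes join_exists: "x \<in> C \<Longrightarrow> y \<in> C \<Longrightarrow> \<exists>s. is_join C le x y s"
    and join_add: "x \<in> C \<Longrightarrow> y \<in> C \<Longrightarrow> z \<in> C \<Longrightarrow> is_join C le x y s \<Longrightarrow>
      is_join C le (add x z) (add y z) (add s z)"

definition riesz_cone ::
  "'c set \<Rightarrow> ('c \<Rightarrow> 'c \<Rightarrow> 'c) \<Rightarrow> 'c \<Rightarrow> (real \<Rightarrow> 'c \<Rightarrow> 'c) \<Rightarrow> bool" where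
  "riesz_cone C add zero smul \<longleftrightarrow>
     abstract_convex_cone C add zero smul \<and> cancellative_on C add \<and>
     lattice_cone C add zero smul (natural_le C add)"


section \<open>Relative Borel measures\<close>

definition borel_measures :: "'a::topological_space measure set" where
  "borel_measures = {\<mu>. sets \<mu> = sets borel}"

definition add_measure :: "'a measure \<Rightarrow> 'a measure \<Rightarrow> 'a measure" where
  "add_measure \<mu> \<nu> = measure_of (space \<mu>) (sets \<mu>) (\<lambda>E. emeasure \<mu> E + emeasure \<nu> E)"

lemma sets_add_measure [simp]: "sets (add_measure \<mu> \<nu>) = sets \<mu>"
  by (simp add: add_measure_def)

lemma emeasure_add_measure:
  assumes "sets \<nu> = sets \<mu>"
  shows "emeasure (add_measure \<mu> \<nu>) E = emeasure \<mu> E + emeasure \<nu> E"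
proof (cases "E \<in> sets \<mu>")
  case True
  show ?thesis
    unfolding add_measure_def
  proof (rule emeasure_measure_of_sigma)
    show "sigma_algebra (space \<mu>) (sets \<mu>)" ..
    show "positive (sets \<mu>) (\<lambda>E. emeasure \<mu> E + emeasure \<nu> E)"
      by (simp add: positive_def)
    show "countably_additive (sets \<mu>) (\<lambda>E. emeasure \<mu> E + emeasure \<nu> E)"
    proof (rule countably_additiveI)
      fix F :: "nat \<Rightarrow> 'a set"
      assume F: "range F \<subseteq> sets \<mu>" "disjoint_family F"
      have "(\<Sum>i. emeasure \<mu> (F i) + emeasure \<nu> (F i)) =
          (\<Sum>i. emeasure \<mu> (F i)) + (\<Sum>i. emeasure \<nu> (F i))"
        by (rule suminf_add [symmetric]) auto
      then show "(\<Sum>i. emeasure \<mu> (F i) + emeasure \<nu> (F i)) =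
          emeasure \<mu> (\<Union>i. F i) + emeasure \<nu> (\<Union>i. F i)"
        using F assms by (simp add: suminf_emeasure)
    qed
  qed (use True in auto)
next
  case False
  then show ?thesis using assms by (simp add: emeasure_notin_sets)
qed

definition concentrated_on :: "'a measure \<Rightarrow> 'a set \<Rightarrow> bool" where
  "concentrated_on \<sigma> A \<longleftrightarrow> emeasure \<sigma> (- A) = 0"

text \<open>The congruence whose quotient is \<open>\<B>\<^sup>+(X, A) = \<B>\<^sup>+(X) / \<B>\<^sup>+(A)\<close>; here \<open>X\<close> is the whole type.\<close>

definition rel_eq :: "'a::topological_space set \<Rightarrow> ('a measure \<times> 'a measure) set" where
  "rel_eq A = {(\<mu>, \<nu>). \<mu> \<in> borel_measures \<and> \<nu> \<in> borel_measures \<and>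
     (\<exists>\<sigma>\<in>borel_measures. \<exists>\<tau>\<in>borel_measures. concentrated_on \<sigma> A \<and> concentrated_on \<tau> A \<and>
        add_measure \<mu> \<sigma> = add_measure \<nu> \<tau>)}"

definition rel_borel_measures :: "'a::topological_space set \<Rightarrow> 'a measure set set" where
  "rel_borel_measures A = borel_measures // rel_eq A"

definition rel_add ::
  "'a::topological_space set \<Rightarrow> 'a measure set \<Rightarrow> 'a measure set \<Rightarrow> 'a measure set" where
  "rel_add A P Q = (\<Union>\<mu>\<in>P. \<Union>\<nu>\<in>Q. rel_eq A `` {add_measure \<mu> \<nu>})"

definition rel_zero :: "'a::topological_space set \<Rightarrow> 'a measure set" where
  "rel_zero A = rel_eq A `` {null_measure borel}"

definition rel_scale ::
  "'a::topological_space set \<Rightarrow> real \<Rightarrow> 'a measure set \<Rightarrow> 'a measure set" where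
  "rel_scale A a P = (\<Union>\<mu>\<in>P. rel_eq A `` {scale_measure (ennreal a) \<mu>})"


section \<open>Relative Radon measures\<close>

definition tight_rel :: "'a::topological_space set \<Rightarrow> 'a measure \<Rightarrow> bool" where
  "tight_rel A \<mu> \<longleftrightarrow> (\<forall>E\<in>sets borel. E \<subseteq> - A \<longrightarrow>
     emeasure \<mu> E = (SUP K\<in>{K. compact K \<and> K \<subseteq> E}. emeasure \<mu> K))"

text \<open>For closed nonempty \<open>A\<close>, \<open>infdist x A > 0\<close> off \<open>A\<close>, so for \<open>p = 0\<close> the integrand is \<open>1\<close> and
  the condition is \<open>\<mu>(X - A) < \<infinity>\<close>.\<close>

definition p_finite :: "ennreal \<Rightarrow> 'a::metric_space set \<Rightarrow> 'a measure \<Rightarrow> bool" where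
  "p_finite p A \<mu> \<longleftrightarrow>
     (if p < \<infinity> then (\<integral>\<^sup>+ x \<in> - A. ennreal (infdist x A powr enn2real p) \<partial>\<mu>) < \<infinity>
      else (\<forall>\<epsilon>>0. emeasure \<mu> {x. infdist x A > \<epsilon>} < \<infinity>) \<and>
           (\<exists>\<delta>>0. emeasure \<mu> {x. infdist x A > \<delta>} = 0))"

definition measure_restr :: "'a measure \<Rightarrow> 'a set \<Rightarrow> 'a measure" where
  "measure_restr \<mu> U = density \<mu> (indicator U)"

lemma emeasure_measure_restr:
  assumes "E \<in> sets \<mu>" "U \<in> sets \<mu>"
  shows "emeasure (measure_restr \<mu> U) E = emeasure \<mu> (E \<inter> U)"
  using assms by (simp add: measure_restr_def emeasure_restricted Int_commute)

text \<open>Neighborhoods need not be open; they are taken Borel so that \<open>E \<inter> U\<close> is measurable.\<close>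

definition locally_p_finite :: "ennreal \<Rightarrow> 'a::metric_space set \<Rightarrow> 'a measure \<Rightarrow> bool" where
  "locally_p_finite p A \<mu> \<longleftrightarrow>
     (\<forall>x. \<exists>U\<in>sets borel. x \<in> interior U \<and> p_finite p A (measure_restr \<mu> U))"

text \<open>Tightness and local \<open>p\<close>-finiteness depend only on the values of a measure on Borel subsets of
  \<open>- A\<close>, i.e. only on its class, so quantifying over all representatives is the same as picking one.\<close>

lemma rel_eq_iff:
  fixes A :: "'a::topological_space set"
  assumes A: "closed A"
  shows "(\<mu>, \<nu>) \<in> rel_eq A \<longleftrightarrow> \<mu> \<in> borel_measures \<and> \<nu> \<in> borel_measures \<and>
    (\<forall>E\<in>sets borel. E \<subseteq> - A \<longrightarrow> emeasure \<mu> E = emeasure \<nu> E)"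
proof (intro iffI conjI ballI impI)
  fix E :: "'a set"
  assume r: "(\<mu>, \<nu>) \<in> rel_eq A" and E: "E \<in> sets borel" "E \<subseteq> - A"
  then obtain \<sigma> \<tau> where *: "sets \<mu> = sets borel" "sets \<nu> = sets borel"
      "sets \<sigma> = sets borel" "sets \<tau> = sets borel"
      "emeasure \<sigma> (- A) = 0" "emeasure \<tau> (- A) = 0" "add_measure \<mu> \<sigma> = add_measure \<nu> \<tau>"
    by (auto simp: rel_eq_def borel_measures_def concentrated_on_def)
  have "- A \<in> sets borel" using A by (auto intro: borel_open)
  then have "emeasure \<sigma> E = 0" "emeasure \<tau> E = 0"
    using * E by (auto intro: emeasure_eq_0)
  moreover have "emeasure \<mu> E + emeasure \<sigma> E = emeasure \<nu> E + emeasure \<tau> E"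
    using * by (simp flip: emeasure_add_measure)
  ultimately show "emeasure \<mu> E = emeasure \<nu> E" by simp
next
  assume h: "\<mu> \<in> borel_measures \<and> \<nu> \<in> borel_measures \<and>
    (\<forall>E\<in>sets borel. E \<subseteq> - A \<longrightarrow> emeasure \<mu> E = emeasure \<nu> E)"
  then have s: "sets \<mu> = sets borel" "sets \<nu> = sets borel" by (auto simp: borel_measures_def)
  have A': "A \<in> sets borel" "- A \<in> sets borel" using A by (auto intro: borel_closed borel_open)
  define \<sigma> where "\<sigma> = measure_restr \<nu> A"
  define \<tau> where "\<tau> = measure_restr \<mu> A"
  have s': "sets \<sigma> = sets borel" "sets \<tau> = sets borel"
    by (simp_all add: \<sigma>_def \<tau>_def measure_restr_def s)
  have "add_measure \<mu> \<sigma> = add_measure \<nu> \<tau>"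
  proof (rule measure_eqI)
    fix E assume "E \<in> sets (add_measure \<mu> \<sigma>)"
    then have E: "E \<in> sets borel" by (simp add: s)
    have split: "emeasure \<rho> E = emeasure \<rho> (E \<inter> A) + emeasure \<rho> (E - A)"
      if "sets \<rho> = sets borel" for \<rho>
      using that E A' by (subst plus_emeasure) (auto intro!: arg_cong[where f="emeasure \<rho>"])
    have "emeasure \<mu> (E - A) = emeasure \<nu> (E - A)" using h E A' by auto
    then show "emeasure (add_measure \<mu> \<sigma>) E = emeasure (add_measure \<nu> \<tau>) E"
      using E A' s s' split[of \<mu>] split[of \<nu>]
      by (simp add: emeasure_add_measure \<sigma>_def \<tau>_def emeasure_measure_restr ac_simps)
  qed (simp add: s)
  moreover have "concentrated_on \<sigma> A" "concentrated_on \<tau> A"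
    using A' s by (simp_all add: concentrated_on_def \<sigma>_def \<tau>_def emeasure_measure_restr)
  ultimately show "(\<mu>, \<nu>) \<in> rel_eq A"
    using h s' by (auto simp: rel_eq_def borel_measures_def)
qed (auto simp: rel_eq_def)

lemma equiv_rel_eq: "closed A \<Longrightarrow> equiv borel_measures (rel_eq A)"
  by (intro equivI) (auto simp: rel_eq_iff intro!: refl_onI symI transI)

definition rel_radon :: "ennreal \<Rightarrow> 'a::metric_space set \<Rightarrow> 'a measure set set" where
  "rel_radon p A =
     {P \<in> rel_borel_measures A. \<forall>\<mu>\<in>P. tight_rel A \<mu> \<and> locally_p_finite p A \<mu>}"

end

theory Submission
  imports Defs
begin

text \<open>Local \<open>p\<close>-finiteness makes a measure finite on the compact subsets of \<open>- A\<close>, and tightness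
  recovers it from these values; this gives cancellation. The natural order is the setwise order on
  \<open>- A\<close>: if \<open>\<mu> \<le> \<nu>\<close> setwise, the difference is the supremum of \<open>\<nu> - \<mu>\<close> over parts of finite
  \<open>\<nu>\<close>-measure, which needs no \<open>\<sigma>\<close>-finiteness because tightness makes \<open>\<nu>\<close> semifinite. Joins are
  joins of measures, \<open>(\<mu> \<squnion> \<nu>)(E) = sup\<^sub>Y \<mu>(E \<inter> Y) + \<nu>(E - Y)\<close>, and translation invariance of joins
  is automatic in a cancellative cone with the natural order.\<close>

section \<open>Cones in the natural order\<close>

text \<open>Reduces everything to the cone axioms and the existence of joins. Reflexivity and
  transitivity of the natural preorder hold in any commutative monoid, cancellation and
  zero-sum-freeness give antisymmetry, and cancellation makes translation reflect the order, so that
  it preserves joins.\<close>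

lemma riesz_coneI:
  assumes "abstract_convex_cone C add zero smul"
    and canc: "cancellative_on C add"
    and zsf: "zero_sum_free_on C add zero"
    and joins: "\<And>x y. x \<in> C \<Longrightarrow> y \<in> C \<Longrightarrow> \<exists>s. is_join C (natural_le C add) x y s"
  shows "riesz_cone C add zero smul"
proof -
  interpret abstract_convex_cone C add zero smul by fact
  have cancD: "x = y" if "x \<in> C" "y \<in> C" "z \<in> C" "add x z = add y z" for x y z
    using canc that unfolding cancellative_on_def by blast
  have add_left_swap: "add a (add b c) = add b (add a c)" if "a \<in> C" "b \<in> C" "c \<in> C" for a b c
    using that by (simp add: add_assoc[symmetric] add_comm[of a b])
  have add_swap: "add (add a b) (add c d) = add (add a c) (add b d)"
    if "a \<in> C" "b \<in> C" "c \<in> C" "d \<in> C" for a b c d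
    using that by (simp add: add_assoc add_closed add_left_swap[of b c d])
  have add_right_swap: "add (add a b) c = add (add a c) b" if "a \<in> C" "b \<in> C" "c \<in> C" for a b c
    using that by (simp add: add_assoc add_comm[of b c])
  let ?le = "natural_le C add"
  have le_mono: "?le (add x w) (add y z)"
    if "x \<in> C" "y \<in> C" "w \<in> C" "z \<in> C" "?le x y" "?le w z" for x y w z
  proof -
    obtain a b where "a \<in> C" "b \<in> C" "y = add x a" "z = add w b"
      using \<open>?le x y\<close> \<open>?le w z\<close> unfolding natural_le_def by blast
    then show ?thesis
      using that add_swap[of x w a b] add_closed unfolding natural_le_def by metis
  qed
  have le_refl: "?le x x" if "x \<in> C" for x
    unfolding natural_le_def using that zero_closed add_zero by blast
  have le_trans: "?le x z" if "x \<in> C" "?le x y" "?le y z" for x y z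
    using that unfolding natural_le_def by (auto simp: add_assoc intro: add_closed)
  have le_antisym: "x = y" if x: "x \<in> C" and "?le x y" "?le y x" for x y
  proof -
    obtain a where a: "a \<in> C" and y: "add x a = y"
      using \<open>?le x y\<close> unfolding natural_le_def by blast
    obtain b where b: "b \<in> C" and "add y b = x"
      using \<open>?le y x\<close> unfolding natural_le_def by blast
    note ab = a b
    \<comment> \<open>Going up from \<open>x\<close> by \<open>a\<close> and back by
      \<open>b\<close> is a translation by \<open>a + b\<close> that fixes \<open>x\<close>.
      Cancelling \<open>x\<close> leaves \<open>a + b = 0\<close>, and zero-sum-freeness then
      removes \<open>a\<close>.\<close>
    have "add (add a b) x = add (add x a) b"
      using ab x by (simp add: add_assoc add_closed add_comm[of _ x])
    also have "\<dots> = add zero x"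
      using x y \<open>add y b = x\<close> by (simp add: add_comm[of zero x] add_zero zero_closed)
    finally have "add a b = zero"
      using ab x cancD[of "add a b" zero x] add_closed zero_closed by blast
    then have "a = zero"
      using zsf ab unfolding zero_sum_free_on_def by blast
    then show "x = y"
      using y x add_zero by metis
  qed
  have "lattice_cone C add zero smul ?le"
  proof unfold_locales
    show "partial_order_on C {(x, y). x \<in> C \<and> y \<in> C \<and> ?le x y}"
      unfolding partial_order_on_def preorder_on_def
    proof (intro conjI)
      show "refl_on C {(x, y). x \<in> C \<and> y \<in> C \<and> ?le x y}"
        by (auto simp: refl_on_def le_refl)
      show "trans {(x, y). x \<in> C \<and> y \<in> C \<and> ?le x y}"
        by (auto intro!: transI intro: le_trans)
      show "antisym {(x, y). x \<in> C \<and> y \<in> C \<and> ?le x y}"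
        by (auto intro!: antisymI intro: le_antisym)
    qed auto
    show "?le (add x w) (add y z)"
      if "x \<in> C" "y \<in> C" "w \<in> C" "z \<in> C" "?le x y" "?le w z" for x y w z
      using that by (rule le_mono)
    show "?le (smul a x) (smul a y)" if "x \<in> C" "y \<in> C" "0 \<le> a" "?le x y" for x y and a :: real
    proof -
      obtain b where "b \<in> C" "add x b = y"
        using \<open>?le x y\<close> unfolding natural_le_def by blast
      then show ?thesis
        unfolding natural_le_def using that scale_add_right scale_closed by metis
    qed
    show "\<exists>s. is_join C ?le x y s" if "x \<in> C" "y \<in> C" for x y
      using that by (rule joins)
    show "is_join C ?le (add x z) (add y z) (add s z)"
      if C: "x \<in> C" "y \<in> C" "z \<in> C" and j: "is_join C ?le x y s" for x y z s
    proof -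
      have s: "s \<in> C" "?le x s" "?le y s" and least: "\<And>u. u \<in> C \<Longrightarrow> ?le x u \<Longrightarrow> ?le y u \<Longrightarrow> ?le s u"
        using j unfolding is_join_def by auto
      have "?le (add s z) u" if u: "u \<in> C" "?le (add x z) u" "?le (add y z) u" for u
      proof -
        obtain a b where ab: "a \<in> C" "b \<in> C" "add (add x z) a = u" "add (add y z) b = u"
          using u unfolding natural_le_def by blast
        \<comment> \<open>An upper bound of \<open>x + z\<close> and \<open>y + z\<close> lies above
          each of them by some \<open>a\<close> and \<open>b\<close>, so it is
          \<open>(x + a) + z = (y + b) + z\<close>. Cancelling \<open>z\<close> exhibits
          \<open>x + a = y + b\<close> as an upper bound of \<open>x\<close> and \<open>y\<close>,
          hence above \<open>s\<close>; adding \<open>z\<close> back gives the claim.\<close>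
        then have xa: "u = add (add x a) z" and "u = add (add y b) z"
          using C add_right_swap by metis+
        then have "add x a = add y b"
          using ab C cancD add_closed by metis
        then have "?le x (add x a)" "?le y (add x a)"
          unfolding natural_le_def using ab by metis+
        then have "?le s (add x a)"
          using least ab C add_closed by blast
        then show ?thesis
          unfolding xa using le_mono[OF s(1) add_closed[OF C(1) ab(1)] C(3) C(3)] le_refl C by blast
      qed
      moreover have "?le (add x z) (add s z)" "?le (add y z) (add s z)"
        using C s by (simp_all add: le_mono le_refl)
      ultimately show ?thesis
        unfolding is_join_def using C s add_closed by blast
    qed
  qed
  then show ?thesis
    unfolding riesz_cone_def using canc \<open>abstract_convex_cone C add zero smul\<close> by blast
qed


section \<open>Measures\<close>

text \<open>Serves the tightness proofs, where two compact sets range independently over different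
  families. Nonempty index sets allow a constant summand to be moved into the supremum.\<close>

lemma SUP_add_SUP_le_ennreal:
  fixes f :: "'a \<Rightarrow> ennreal" and g :: "'b \<Rightarrow> ennreal"
  assumes "I \<noteq> {}" "J \<noteq> {}" and "\<And>i j. i \<in> I \<Longrightarrow> j \<in> J \<Longrightarrow> f i + g j \<le> c"
  shows "(SUP i\<in>I. f i) + (SUP j\<in>J. g j) \<le> c"
proof -
  have "f i + (SUP j\<in>J. g j) \<le> c" if "i \<in> I" for i
    unfolding ennreal_SUP_add_right[OF assms(2)] using assms(3) that by (intro SUP_least)
  then show ?thesis
    unfolding ennreal_SUP_add_left[OF assms(1), symmetric] by (intro SUP_least)
qed

lemma nn_integral_add_measure:
  assumes S: "sets \<nu> = sets \<mu>" and f: "f \<in> borel_measurable \<mu>"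
  shows "nn_integral (add_measure \<mu> \<nu>) f = nn_integral \<mu> f + nn_integral \<nu> f"
proof -
  have sp: "space (add_measure \<mu> \<nu>) = space \<mu>" "space \<nu> = space \<mu>"
    using S by (intro sets_eq_imp_space_eq; simp)+
  have meas: "g \<in> borel_measurable (add_measure \<mu> \<nu>)" "g \<in> borel_measurable \<nu>"
    if "g \<in> borel_measurable \<mu>" for g :: "'a \<Rightarrow> ennreal"
    using that S by (simp_all cong: measurable_cong_sets)
  show ?thesis
    using f
  proof (induction rule: borel_measurable_induct)
    case (cong f g)
    then have "nn_integral M f = nn_integral M g" if "space M = space \<mu>" for M
      using that by (intro nn_integral_cong) auto
    with cong sp show ?case by simp
  next
    case (set B)
    with S show ?case by (simp add: emeasure_add_measure)
  next
    case (mult u c)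
    then show ?case by (simp add: nn_integral_cmult distrib_left meas)
  next
    case (add u v)
    then show ?case by (simp add: nn_integral_add ac_simps meas)
  next
    case (seq U)
    \<comment> \<open>Suprema of sums split only along increasing sequences, so the limit step needs
      the integrals to be monotone in \<open>i\<close>.\<close>
    have mono: "incseq (\<lambda>i. nn_integral M (U i))" for M
    proof (rule incseq_SucI)
      show "nn_integral M (U i) \<le> nn_integral M (U (Suc i))" for i
        using \<open>incseq U\<close> by (intro nn_integral_mono) (simp add: incseq_Suc_iff le_fun_def)
    qed
    have U: "Sup (range U) = (\<lambda>x. SUP i. U i x)"
      by (simp add: fun_eq_iff image_comp)
    have "nn_integral M (Sup (range U)) = (SUP i. nn_integral M (U i))"
      if "\<And>i. U i \<in> borel_measurable M" for M
      unfolding U using \<open>incseq U\<close> that by (rule nn_integral_monotone_convergence_SUP)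
    note SUP = this[of \<mu>] this[of \<nu>] this[of "add_measure \<mu> \<nu>"]
    show ?case
      by (simp only: SUP seq meas ennreal_SUP_add[OF mono mono])
  qed
qed

text \<open>Only the parts of finite \<open>\<nu>\<close>-measure enter, since \<open>\<nu> - \<mu>\<close> is meaningless where both
  are infinite.\<close>

definition diff_measure_fin :: "'a measure \<Rightarrow> 'a measure \<Rightarrow> 'a measure" where
  "diff_measure_fin \<nu> \<mu> = measure_of (space \<nu>) (sets \<nu>)
     (\<lambda>E. SUP F\<in>{F \<in> sets \<nu>. emeasure \<nu> F < \<infinity>}. emeasure \<nu> (F \<inter> E) - emeasure \<mu> (F \<inter> E))"

lemma sets_diff_measure_fin [simp]: "sets (diff_measure_fin \<nu> \<mu>) = sets \<nu>"
  by (simp add: diff_measure_fin_def)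

section \<open>Subtracting a measure from a larger one\<close>

context
  fixes \<mu> \<nu> :: "'a measure"
  assumes S: "sets \<mu> = sets \<nu>"
    and le: "\<And>E. E \<in> sets \<nu> \<Longrightarrow> emeasure \<mu> E \<le> emeasure \<nu> E"
begin

text \<open>After adding \<mu>(G) to both sides the claim becomes \<nu>(E) + \<mu>(G - E) \<le>
  \<nu>(G), which is the domination of \<mu> by \<nu> on \<open>G - E\<close>. This makes the family
  defining \<open>diff_measure_fin\<close> increase with \<open>F\<close>.\<close>

lemma emeasure_diff_mono:
  assumes "E \<in> sets \<nu>" "G \<in> sets \<nu>" "E \<subseteq> G"
  shows "emeasure \<nu> E - emeasure \<mu> E \<le> emeasure \<nu> G - emeasure \<mu> G"
proof -
  have split: "emeasure M G = emeasure M E + emeasure M (G - E)" if "sets M = sets \<nu>" for M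
    using assms that by (subst plus_emeasure) (auto intro!: arg_cong[where f = "emeasure M"])
  have "emeasure \<nu> E - emeasure \<mu> E + emeasure \<mu> G = emeasure \<nu> E + emeasure \<mu> (G - E)"
    using le[of E] assms S by (simp add: split add.assoc[symmetric] diff_add_cancel_ennreal)
  also have "\<dots> \<le> emeasure \<nu> G"
    using le[of "G - E"] assms by (simp add: split add_left_mono)
  finally show ?thesis
    by (simp add: ennreal_le_minus_iff)
qed

lemma emeasure_diff_measure_fin:
  assumes E: "E \<in> sets \<nu>"
  shows "emeasure (diff_measure_fin \<nu> \<mu>) E =
    (SUP F\<in>{F \<in> sets \<nu>. emeasure \<nu> F < \<infinity>}. emeasure \<nu> (F \<inter> E) - emeasure \<mu> (F \<inter> E))"
  unfolding diff_measure_fin_def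
proof (rule emeasure_measure_of_sigma)
  let ?I = "{F \<in> sets \<nu>. emeasure \<nu> F < \<infinity>}"
  let ?d = "\<lambda>F E. emeasure \<nu> (F \<inter> E) - emeasure \<mu> (F \<inter> E)"
  show "sigma_algebra (space \<nu>) (sets \<nu>)" ..
  show "positive (sets \<nu>) (\<lambda>E. SUP F\<in>?I. ?d F E)"
    unfolding positive_def by (intro antisym SUP_least) simp_all
  show "countably_additive (sets \<nu>) (\<lambda>E. SUP F\<in>?I. ?d F E)"
  proof (rule countably_additiveI)
    fix E :: "nat \<Rightarrow> 'a set"
    assume E: "range E \<subseteq> sets \<nu>" "disjoint_family E"
    have fin: "emeasure \<nu> (F \<inter> B) < \<infinity>" if "F \<in> ?I" for F B
      using that emeasure_mono[of "F \<inter> B" F \<nu>] by (auto intro: le_less_trans)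
    \<comment> \<open>Sets of finite \<nu>-measure are closed under finite unions and the
      differences grow with \<open>F\<close>, so the family is directed and the supremum commutes
      with the infinite sum.\<close>
    have "(\<Sum>n. SUP F\<in>?I. ?d F (E n)) = (SUP F\<in>?I. \<Sum>n. ?d F (E n))"
    proof (rule ennreal_suminf_SUP_eq_directed)
      fix F G and N :: "nat set"
      assume FG: "F \<in> ?I" "G \<in> ?I"
      have "emeasure \<nu> (F \<union> G) \<le> emeasure \<nu> F + emeasure \<nu> G"
        using FG by (intro emeasure_subadditive) auto
      also have "\<dots> < \<infinity>"
        using FG by simp
      finally have H: "F \<union> G \<in> ?I"
        using FG by auto
      have "?d F (E n) \<le> ?d (F \<union> G) (E n)" "?d G (E n) \<le> ?d (F \<union> G) (E n)" for n
        using FG E H by (auto intro!: emeasure_diff_mono)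
      with H show "\<exists>H\<in>?I. \<forall>n\<in>N. ?d F (E n) \<le> ?d H (E n) \<and> ?d G (E n) \<le> ?d H (E n)"
        by blast
    qed
    also have "\<dots> = (SUP F\<in>?I. ?d F (\<Union>n. E n))"
    proof (rule SUP_cong)
      fix F assume F: "F \<in> ?I"
      have sum: "(\<Sum>n. emeasure M (F \<inter> E n)) = emeasure M (F \<inter> (\<Union>n. E n))"
        if "sets M = sets \<nu>" for M
      proof -
        have "(\<Sum>n. emeasure M (F \<inter> E n)) = emeasure M (\<Union>n. F \<inter> E n)"
          using E F that by (intro suminf_emeasure) (auto simp: disjoint_family_on_def)
        then show ?thesis by simp
      qed
      have "emeasure \<mu> (F \<inter> (\<Union>n. E n)) \<le> emeasure \<nu> (F \<inter> (\<Union>n. E n))"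
        using F E by (intro le) auto
      \<comment> \<open>Inside a fixed \<open>F\<close> both series have finite sums, which permits
        subtracting them term by term.\<close>
      then have "(\<Sum>n. emeasure \<nu> (F \<inter> E n)) \<noteq> top" "(\<Sum>n. emeasure \<mu> (F \<inter> E n)) \<noteq> top"
        using fin[OF F, of "\<Union>n. E n"] by (auto simp: sum S top_unique)
      moreover have "emeasure \<mu> (F \<inter> E n) \<le> emeasure \<nu> (F \<inter> E n)" for n
        using F E by (intro le) auto
      ultimately show "(\<Sum>n. ?d F (E n)) = ?d F (\<Union>n. E n)"
        by (simp add: ennreal_suminf_minus sum S)
    qed simp
    finally show "(\<Sum>n. SUP F\<in>?I. ?d F (E n)) = (SUP F\<in>?I. ?d F (\<Union>n. E n))" .
  qed
qed (use E in auto)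

text \<open>The left side is the supremum over \<open>F\<close> of \<mu>(E - F) + \<nu>(F \<inter>
  E). Each such value is at most \<nu>(E) and at least \<nu>(F \<inter> E), and semifiniteness says
  that the latter values reach \<nu>(E).\<close>

lemma emeasure_add_diff_measure_fin:
  assumes E: "E \<in> sets \<nu>"
    and semifinite: "emeasure \<nu> E \<le> (SUP F\<in>{F \<in> sets \<nu>. emeasure \<nu> F < \<infinity>}. emeasure \<nu> (F \<inter> E))"
  shows "emeasure \<mu> E + emeasure (diff_measure_fin \<nu> \<mu>) E = emeasure \<nu> E"
proof -
  let ?I = "{F \<in> sets \<nu>. emeasure \<nu> F < \<infinity>}"
  let ?d = "\<lambda>F. emeasure \<nu> (F \<inter> E) - emeasure \<mu> (F \<inter> E)"
  have "{} \<in> ?I" by simp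
  then have "?I \<noteq> {}" by blast
  then have eq: "emeasure \<mu> E + emeasure (diff_measure_fin \<nu> \<mu>) E = (SUP F\<in>?I. emeasure \<mu> E + ?d F)"
    by (simp add: emeasure_diff_measure_fin[OF E] ennreal_SUP_add_right)
  \<comment> \<open>Adding the difference on \<open>F\<close> replaces \<mu> by \<nu> there and
    keeps \<mu> on the rest of \<open>E\<close>.\<close>
  have step: "emeasure \<mu> E + ?d F = emeasure \<mu> (E - F) + emeasure \<nu> (F \<inter> E)" if "F \<in> ?I" for F
  proof -
    have "emeasure \<mu> E = emeasure \<mu> (E - F) + emeasure \<mu> (F \<inter> E)"
      using that E S by (subst plus_emeasure) (auto intro!: arg_cong[where f = "emeasure \<mu>"])
    moreover have "emeasure \<mu> (F \<inter> E) \<le> emeasure \<nu> (F \<inter> E)"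
      using that E by (intro le) auto
    ultimately show ?thesis
      by (simp add: add.assoc add_diff_inverse_ennreal)
  qed
  have "emeasure \<mu> (E - F) + emeasure \<nu> (F \<inter> E) \<le> emeasure \<nu> E" if "F \<in> ?I" for F
  proof -
    have "emeasure \<mu> (E - F) + emeasure \<nu> (F \<inter> E) \<le> emeasure \<nu> (E - F) + emeasure \<nu> (F \<inter> E)"
      using that E by (intro add_right_mono le) auto
    also have "\<dots> = emeasure \<nu> E"
      using that E by (subst plus_emeasure) (auto intro!: arg_cong[where f = "emeasure \<nu>"])
    finally show ?thesis .
  qed
  then have "(SUP F\<in>?I. emeasure \<mu> E + ?d F) \<le> emeasure \<nu> E"
    by (intro SUP_least) (simp only: step)
  moreover have "emeasure \<nu> E \<le> (SUP F\<in>?I. emeasure \<mu> E + ?d F)"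
  proof (rule order_trans[OF semifinite], intro SUP_mono bexI)
    fix F assume "F \<in> ?I"
    then show "emeasure \<nu> (F \<inter> E) \<le> emeasure \<mu> E + ?d F"
      by (simp only: step) simp
  qed
  ultimately show ?thesis
    using eq by simp
qed

end


section \<open>Tightness and local finiteness\<close>

lemma tight_relI:
  fixes A :: "'a::t2_space set"
  assumes "sets \<mu> = sets borel"
    and "\<And>E. E \<in> sets borel \<Longrightarrow> E \<subseteq> - A \<Longrightarrow>
      emeasure \<mu> E \<le> (SUP K\<in>{K. compact K \<and> K \<subseteq> E}. emeasure \<mu> K)"
  shows "tight_rel A \<mu>"
  unfolding tight_rel_def
proof (intro ballI impI antisym)
  fix E :: "'a set" assume "E \<in> sets borel" "E \<subseteq> - A"
  then show "(SUP K\<in>{K. compact K \<and> K \<subseteq> E}. emeasure \<mu> K) \<le> emeasure \<mu> E"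
    using assms(1) by (auto intro!: SUP_least emeasure_mono)
qed (use assms(2) in auto)

lemma tight_relD:
  "tight_rel A \<mu> \<Longrightarrow> E \<in> sets borel \<Longrightarrow> E \<subseteq> - A \<Longrightarrow>
    emeasure \<mu> E = (SUP K\<in>{K. compact K \<and> K \<subseteq> E}. emeasure \<mu> K)"
  unfolding tight_rel_def by blast

lemma tight_rel_cong:
  fixes A :: "'a::t2_space set"
  assumes "\<And>E. E \<in> sets borel \<Longrightarrow> E \<subseteq> - A \<Longrightarrow> emeasure \<mu> E = emeasure \<nu> E"
    and "tight_rel A \<mu>"
  shows "tight_rel A \<nu>"
  unfolding tight_rel_def
proof (intro ballI impI)
  fix E :: "'a set" assume E: "E \<in> sets borel" "E \<subseteq> - A"
  have "(SUP K\<in>{K. compact K \<and> K \<subseteq> E}. emeasure \<mu> K) = (SUP K\<in>{K. compact K \<and> K \<subseteq> E}. emeasure \<nu> K)"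
    using E by (intro SUP_cong refl assms(1)) (auto intro: borel_compact)
  then show "emeasure \<nu> E = (SUP K\<in>{K. compact K \<and> K \<subseteq> E}. emeasure \<nu> K)"
    using assms(1)[OF E] tight_relD[OF assms(2) E] by simp
qed

text \<open>If \<open>K\<close> is good for \<mu> and \<open>L\<close> for \<nu>, then the compact
  set \<open>K \<union> L\<close> is good for both at once.\<close>

lemma tight_rel_add:
  fixes A :: "'a::t2_space set"
  assumes S: "sets \<mu> = sets borel" "sets \<nu> = sets borel" and T: "tight_rel A \<mu>" "tight_rel A \<nu>"
  shows "tight_rel A (add_measure \<mu> \<nu>)"
proof (rule tight_relI)
  fix E :: "'a set" assume E: "E \<in> sets borel" "E \<subseteq> - A"
  let ?I = "{K. compact K \<and> K \<subseteq> E}"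
  have "?I \<noteq> {}" by auto
  have "emeasure \<mu> K + emeasure \<nu> L \<le> (SUP K\<in>?I. emeasure (add_measure \<mu> \<nu>) K)"
    if "K \<in> ?I" "L \<in> ?I" for K L
  proof (rule SUP_upper2)
    show "K \<union> L \<in> ?I" using that by auto
    show "emeasure \<mu> K + emeasure \<nu> L \<le> emeasure (add_measure \<mu> \<nu>) (K \<union> L)"
      using that S by (auto simp: emeasure_add_measure intro!: add_mono emeasure_mono borel_compact)
  qed
  then have "(SUP K\<in>?I. emeasure \<mu> K) + (SUP L\<in>?I. emeasure \<nu> L)
      \<le> (SUP K\<in>?I. emeasure (add_measure \<mu> \<nu>) K)"
    by (rule SUP_add_SUP_le_ennreal[OF \<open>?I \<noteq> {}\<close> \<open>?I \<noteq> {}\<close>])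
  then show "emeasure (add_measure \<mu> \<nu>) E \<le> (SUP K\<in>?I. emeasure (add_measure \<mu> \<nu>) K)"
    using S T[THEN tight_relD, OF E] by (simp add: emeasure_add_measure)
qed (use S in simp)

lemma tight_rel_scale: "tight_rel A \<mu> \<Longrightarrow> tight_rel A (scale_measure c \<mu>)"
  by (simp add: tight_rel_def SUP_mult_left_ennreal)

lemma tight_rel_sup_measure':
  fixes A :: "'a::t2_space set"
  assumes S: "sets \<mu> = sets borel" "sets \<nu> = sets borel" and T: "tight_rel A \<mu>" "tight_rel A \<nu>"
  shows "tight_rel A (sup_measure' \<mu> \<nu>)"
proof (rule tight_relI)
  let ?s = "sup_measure' \<mu> \<nu>"
  show s: "sets ?s = sets borel" using S by simp
  fix E :: "'a set" assume E: "E \<in> sets borel" "E \<subseteq> - A"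
  let ?c = "SUP K\<in>{K. compact K \<and> K \<subseteq> E}. emeasure ?s K"
  \<comment> \<open>The value of \<open>sup_measure'\<close> at \<open>E\<close> is the supremum of
    these sums over Borel \<open>Y\<close>. Compact sets chosen inside \<open>E \<inter> Y\<close>
    and \<open>E \<inter> - Y\<close> are disjoint, so their values under the join add up to the
    value at their union.\<close>
  have "emeasure \<mu> (E \<inter> Y) + emeasure \<nu> (E \<inter> - Y) \<le> ?c" if Y: "Y \<in> sets borel" for Y
  proof -
    have EY: "E \<inter> Y \<in> sets borel" "E \<inter> Y \<subseteq> - A" "E \<inter> - Y \<in> sets borel" "E \<inter> - Y \<subseteq> - A"
      using E Y by (auto simp: Diff_eq[symmetric])
    have "emeasure \<mu> K + emeasure \<nu> L \<le> ?c"
      if K: "K \<in> {K. compact K \<and> K \<subseteq> E \<inter> Y}" and L: "L \<in> {L. compact L \<and> L \<subseteq> E \<inter> - Y}" for K L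
    proof (rule SUP_upper2)
      show "K \<union> L \<in> {K. compact K \<and> K \<subseteq> E}" using K L by auto
      have KL: "K \<in> sets borel" "L \<in> sets borel" "K \<inter> L = {}"
        using K L by (auto intro: borel_compact)
      have "emeasure \<mu> K + emeasure \<nu> L \<le> emeasure ?s K + emeasure ?s L"
        using S KL by (intro add_mono le_emeasure_sup_measure'1 le_emeasure_sup_measure'2) auto
      also have "\<dots> = emeasure ?s (K \<union> L)"
        using KL s by (intro plus_emeasure) auto
      finally show "emeasure \<mu> K + emeasure \<nu> L \<le> emeasure ?s (K \<union> L)" .
    qed
    then have "(SUP K\<in>{K. compact K \<and> K \<subseteq> E \<inter> Y}. emeasure \<mu> K) +
        (SUP L\<in>{L. compact L \<and> L \<subseteq> E \<inter> - Y}. emeasure \<nu> L) \<le> ?c"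
      by (intro SUP_add_SUP_le_ennreal) auto
    then show ?thesis
      using tight_relD[OF T(1) EY(1,2)] tight_relD[OF T(2) EY(3,4)] by simp
  qed
  then show "emeasure ?s E \<le> ?c"
    using S E by (simp add: emeasure_sup_measure' SUP_least)
qed

section \<open>Stability of p-finiteness and of its local form\<close>

lemma p_finite_mono:
  fixes A :: "'a::metric_space set"
  assumes A: "closed A" and S: "sets \<rho> = sets borel" "sets \<sigma> = sets borel"
    and le: "\<And>E. E \<in> sets borel \<Longrightarrow> E \<subseteq> - A \<Longrightarrow> emeasure \<rho> E \<le> emeasure \<sigma> E"
    and fin: "p_finite p A \<sigma>"
  shows "p_finite p A \<rho>"
proof (cases "p < \<infinity>")
  case True
  let ?f = "\<lambda>x. ennreal (infdist x A powr enn2real p)"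
  note [measurable_cong] = S
  have [measurable]: "- A \<in> sets borel" using A by (auto intro: borel_open)
  have [measurable]: "(\<lambda>x. infdist x A) \<in> borel_measurable borel"
    by (intro borel_measurable_continuous_onI continuous_intros)
  have dens: "(\<integral>\<^sup>+x\<in>- A. ?f x \<partial>M) = nn_integral (density M (indicator (- A))) ?f"
    if [measurable_cong]: "sets M = sets borel" for M
    by (subst nn_integral_density) (auto simp: mult.commute)
  \<comment> \<open>The measures are comparable only off \<open>A\<close>. Restricting both to
    \<open>- A\<close> makes them comparable as measures on the whole space without changing the
    integrals.\<close>
  have "density \<rho> (indicator (- A)) \<le> density \<sigma> (indicator (- A))"
    using S sets_eq_imp_space_eq[of \<rho> \<sigma>]
    by (auto simp: le_measure emeasure_restricted le_fun_def intro!: le)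
  then have "nn_integral (density \<rho> (indicator (- A))) ?f \<le> nn_integral (density \<sigma> (indicator (- A))) ?f"
    using S by (intro nn_integral_mono_measure) auto
  then show ?thesis
    using fin True S by (auto simp: p_finite_def dens intro: le_less_trans)
next
  case False
  have le': "emeasure \<rho> {x. infdist x A > \<epsilon>} \<le> emeasure \<sigma> {x. infdist x A > \<epsilon>}" if "\<epsilon> > 0" for \<epsilon>
  proof (rule le)
    show "{x. infdist x A > \<epsilon>} \<in> sets borel"
      by (intro borel_open open_Collect_less continuous_intros)
    show "{x. infdist x A > \<epsilon>} \<subseteq> - A"
      using that by auto
  qed
  then have "emeasure \<rho> {x. infdist x A > \<epsilon>} < \<infinity>" if "\<epsilon> > 0" for \<epsilon>
    using fin False that unfolding p_finite_def by (metis order_le_less_trans)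
  moreover obtain \<delta> where "\<delta> > 0" "emeasure \<sigma> {x. infdist x A > \<delta>} = 0"
    using fin False unfolding p_finite_def by auto
  then have "\<exists>\<delta>>0. emeasure \<rho> {x. infdist x A > \<delta>} = 0"
    using le'[of \<delta>] by auto
  ultimately show ?thesis
    using False unfolding p_finite_def by auto
qed

lemma p_finite_add:
  fixes A :: "'a::metric_space set"
  assumes A: "closed A" and S: "sets \<rho> = sets borel" "sets \<sigma> = sets borel"
    and fin: "p_finite p A \<rho>" "p_finite p A \<sigma>"
  shows "p_finite p A (add_measure \<rho> \<sigma>)"
proof (cases "p < \<infinity>")
  case True
  note [measurable_cong] = S
  have [measurable]: "- A \<in> sets borel" using A by (auto intro: borel_open)
  have [measurable]: "(\<lambda>x. infdist x A) \<in> borel_measurable borel"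
    by (intro borel_measurable_continuous_onI continuous_intros)
  have "(\<lambda>x. ennreal (infdist x A powr enn2real p) * indicator (- A) x) \<in> borel_measurable \<rho>"
    by measurable
  then show ?thesis
    using fin True S by (simp add: p_finite_def nn_integral_add_measure)
next
  case False
  let ?D = "\<lambda>\<epsilon>. {x. infdist x A > \<epsilon>}"
  have D: "?D \<epsilon> \<in> sets borel" for \<epsilon>
    by (intro borel_open open_Collect_less continuous_intros)
  obtain \<delta> \<eta> where \<delta>: "\<delta> > 0" "emeasure \<rho> (?D \<delta>) = 0" and \<eta>: "\<eta> > 0" "emeasure \<sigma> (?D \<eta>) = 0"
    using fin False unfolding p_finite_def by auto
  \<comment> \<open>The two measures vanish beyond possibly different distances from
    \<open>A\<close>; the larger distance works for both.\<close>
  have "emeasure \<rho> (?D (max \<delta> \<eta>)) = 0"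
    using D S by (intro emeasure_eq_0[OF _ \<delta>(2)]) auto
  moreover have "emeasure \<sigma> (?D (max \<delta> \<eta>)) = 0"
    using D S by (intro emeasure_eq_0[OF _ \<eta>(2)]) auto
  ultimately have "\<exists>\<delta>>0. emeasure (add_measure \<rho> \<sigma>) (?D \<delta>) = 0"
    using \<delta>(1) S by (auto simp: emeasure_add_measure intro!: exI[of _ "max \<delta> \<eta>"])
  then show ?thesis
    using fin False S by (simp add: p_finite_def emeasure_add_measure)
qed

lemma p_finite_scale:
  fixes A :: "'a::metric_space set"
  assumes A: "closed A" and S: "sets \<rho> = sets borel" and fin: "p_finite p A \<rho>" and c: "c < \<infinity>"
  shows "p_finite p A (scale_measure c \<rho>)"
proof (cases "p < \<infinity>")
  case True
  note [measurable_cong] = S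
  have [measurable]: "- A \<in> sets borel" using A by (auto intro: borel_open)
  have [measurable]: "(\<lambda>x. infdist x A) \<in> borel_measurable borel"
    by (intro borel_measurable_continuous_onI continuous_intros)
  have "(\<lambda>x. ennreal (infdist x A powr enn2real p) * indicator (- A) x) \<in> borel_measurable \<rho>"
    by measurable
  then show ?thesis
    using fin True S c by (simp add: p_finite_def nn_integral_scale_measure ennreal_mult_less_top)
next
  case False
  then show ?thesis
    using fin c by (auto simp: p_finite_def ennreal_mult_less_top)
qed

lemma sets_measure_restr [simp]: "sets (measure_restr \<mu> U) = sets \<mu>"
  by (simp add: measure_restr_def)

lemma locally_p_finite_mono:
  fixes A :: "'a::metric_space set"
  assumes A: "closed A" and S: "sets \<rho> = sets borel" "sets \<sigma> = sets borel"
    and le: "\<And>E. E \<in> sets borel \<Longrightarrow> E \<subseteq> - A \<Longrightarrow> emeasure \<rho> E \<le> emeasure \<sigma> E"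
    and fin: "locally_p_finite p A \<sigma>"
  shows "locally_p_finite p A \<rho>"
  unfolding locally_p_finite_def
proof
  fix x
  obtain U where U: "U \<in> sets borel" "x \<in> interior U" "p_finite p A (measure_restr \<sigma> U)"
    using fin unfolding locally_p_finite_def by blast
  have "p_finite p A (measure_restr \<rho> U)"
    by (rule p_finite_mono[OF A _ _ _ U(3)]) (use S U in \<open>auto simp: emeasure_measure_restr intro!: le\<close>)
  with U show "\<exists>U\<in>sets borel. x \<in> interior U \<and> p_finite p A (measure_restr \<rho> U)"
    by blast
qed

lemma locally_p_finite_add:
  fixes A :: "'a::metric_space set"
  assumes A: "closed A" and S: "sets \<rho> = sets borel" "sets \<sigma> = sets borel"
    and fin: "locally_p_finite p A \<rho>" "locally_p_finite p A \<sigma>"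
  shows "locally_p_finite p A (add_measure \<rho> \<sigma>)"
  unfolding locally_p_finite_def
proof
  fix x
  obtain U where U: "U \<in> sets borel" "x \<in> interior U" "p_finite p A (measure_restr \<rho> U)"
    using fin unfolding locally_p_finite_def by blast
  obtain V where V: "V \<in> sets borel" "x \<in> interior V" "p_finite p A (measure_restr \<sigma> V)"
    using fin unfolding locally_p_finite_def by blast
  have sum: "p_finite p A (add_measure (measure_restr \<rho> U) (measure_restr \<sigma> V))"
    using p_finite_add[OF A _ _ U(3) V(3)] S by simp
  \<comment> \<open>The two neighborhoods differ in general. On their intersection the sum is
    dominated by the sum of the separate restrictions, which is p-finite.\<close>
  have "emeasure (measure_restr (add_measure \<rho> \<sigma>) (U \<inter> V)) E
      \<le> emeasure (add_measure (measure_restr \<rho> U) (measure_restr \<sigma> V)) E" if "E \<in> sets borel" for E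
    using S U V that
    by (auto simp: emeasure_measure_restr emeasure_add_measure intro!: add_mono emeasure_mono)
  then have "p_finite p A (measure_restr (add_measure \<rho> \<sigma>) (U \<inter> V))"
    by (intro p_finite_mono[OF A _ _ _ sum]) (use S in auto)
  with U V show "\<exists>W\<in>sets borel. x \<in> interior W \<and> p_finite p A (measure_restr (add_measure \<rho> \<sigma>) W)"
    by (intro bexI[of _ "U \<inter> V"]) auto
qed

lemma locally_p_finite_scale:
  fixes A :: "'a::metric_space set"
  assumes A: "closed A" and S: "sets \<rho> = sets borel" and fin: "locally_p_finite p A \<rho>" and c: "c < \<infinity>"
  shows "locally_p_finite p A (scale_measure c \<rho>)"
  unfolding locally_p_finite_def
proof
  fix x
  obtain U where U: "U \<in> sets borel" "x \<in> interior U" "p_finite p A (measure_restr \<rho> U)"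
    using fin unfolding locally_p_finite_def by blast
  have "p_finite p A (scale_measure c (measure_restr \<rho> U))"
    using p_finite_scale[OF A _ U(3) c] S by simp
  then have "p_finite p A (measure_restr (scale_measure c \<rho>) U)"
    by (rule p_finite_mono[OF A, rotated 3]) (use S U in \<open>auto simp: emeasure_measure_restr\<close>)
  with U show "\<exists>U\<in>sets borel. x \<in> interior U \<and> p_finite p A (measure_restr (scale_measure c \<rho>) U)"
    by blast
qed

text \<open>For finite \<open>p\<close> this is Markov's inequality: the integrand is at least the
  positive constant \<open>\<epsilon> powr p\<close> on the set. For infinite \<open>p\<close> it is
  part of the definition.\<close>

lemma emeasure_infdist_gt_finite:
  fixes A :: "'a::metric_space set"
  assumes A: "closed A" and S: "sets \<sigma> = sets borel" and fin: "p_finite p A \<sigma>" and \<epsilon>: "\<epsilon> > 0"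
  shows "emeasure \<sigma> {x. infdist x A > \<epsilon>} < \<infinity>"
proof (cases "p < \<infinity>")
  case True
  let ?D = "{x. infdist x A > \<epsilon>}" and ?r = "enn2real p"
  have D: "?D \<in> sets \<sigma>"
    unfolding S by (intro borel_open open_Collect_less continuous_intros)
  have "ennreal (\<epsilon> powr ?r) * emeasure \<sigma> ?D = (\<integral>\<^sup>+x. ennreal (\<epsilon> powr ?r) * indicator ?D x \<partial>\<sigma>)"
    using D by (simp add: nn_integral_cmult_indicator)
  also have "\<dots> \<le> (\<integral>\<^sup>+x\<in>- A. ennreal (infdist x A powr ?r) \<partial>\<sigma>)"
    using \<epsilon> by (intro nn_integral_mono) (auto simp: indicator_def intro!: ennreal_leI powr_mono2)
  also have "\<dots> < \<infinity>"
    using fin True by (simp add: p_finite_def)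
  finally show ?thesis
    using \<epsilon> by (auto simp: ennreal_mult_less_top)
qed (use fin \<epsilon> in \<open>auto simp: p_finite_def\<close>)

text \<open>A weight bounded away from zero turns p-finiteness into finiteness. This happens near
  each point off \<open>A\<close>, so \<open>K\<close> is covered by finitely many open sets of
  finite measure.\<close>

lemma locally_p_finite_compact:
  fixes A :: "'a::metric_space set"
  assumes A: "closed A" "A \<noteq> {}" and S: "sets \<mu> = sets borel" and fin: "locally_p_finite p A \<mu>"
    and K: "compact K" "K \<subseteq> - A"
  shows "emeasure \<mu> K < \<infinity>"
proof -
  have "\<exists>W. open W \<and> x \<in> W \<and> emeasure \<mu> W < \<infinity>" if "x \<in> K" for x
  proof -
    define \<epsilon> where "\<epsilon> = infdist x A / 2"
    \<comment> \<open>\<open>infdist\<close> to the empty set is 0 by convention, so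
      \<open>A \<noteq> {}\<close> enters here.\<close>
    have "infdist x A > 0"
      using A K that infdist_pos_not_in_closed[of A x] by blast
    then have \<epsilon>: "\<epsilon> > 0" "\<epsilon> < infdist x A"
      unfolding \<epsilon>_def by auto
    obtain U where U: "U \<in> sets borel" "x \<in> interior U" "p_finite p A (measure_restr \<mu> U)"
      using fin unfolding locally_p_finite_def by blast
    let ?D = "{x. infdist x A > \<epsilon>}"
    have D: "open ?D" by (intro open_Collect_less continuous_intros)
    \<comment> \<open>The interior supplies an open set for the covering, while p-finiteness
      concerns the restriction to all of \<open>U\<close>.\<close>
    have "emeasure \<mu> (?D \<inter> interior U) \<le> emeasure \<mu> (?D \<inter> U)"
      using U D S interior_subset[of U] by (intro emeasure_mono) (auto intro: borel_open)
    also have "\<dots> = emeasure (measure_restr \<mu> U) ?D"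
      using U D S by (auto simp: emeasure_measure_restr borel_open)
    also have "\<dots> < \<infinity>"
      using emeasure_infdist_gt_finite[OF A(1) _ U(3) \<epsilon>(1)] S by simp
    finally show ?thesis
      using U D \<epsilon> by (intro exI[of _ "?D \<inter> interior U"]) auto
  qed
  then obtain W where W: "\<And>x. x \<in> K \<Longrightarrow> open (W x) \<and> x \<in> W x \<and> emeasure \<mu> (W x) < \<infinity>"
    by metis
  then have "K \<subseteq> (\<Union>x\<in>K. W x)" "\<forall>x\<in>K. open (W x)"
    by auto
  then obtain F where F: "F \<subseteq> K" "finite F" "K \<subseteq> (\<Union>x\<in>F. W x)"
    using compactE_image[OF K(1), of K W] by auto
  have sub: "W ` F \<subseteq> sets \<mu>" using F W S by (auto intro!: borel_open)
  have "emeasure \<mu> K \<le> emeasure \<mu> (\<Union>x\<in>F. W x)"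
    using F sub by (intro emeasure_mono) auto
  also have "\<dots> \<le> (\<Sum>x\<in>F. emeasure \<mu> (W x))"
    using F sub by (intro emeasure_subadditive_finite) auto
  also have "\<dots> < \<infinity>"
    using F W by (auto simp: subset_iff)
  finally show ?thesis .
qed


section \<open>Representatives of relative Radon measures\<close>

text \<open>For closed \<open>A\<close> this is the union of the classes in
  \<open>rel_radon p A\<close>, so that statements about classes can be proved on measures.\<close>

definition radon :: "ennreal \<Rightarrow> 'a::metric_space set \<Rightarrow> 'a measure set" where
  "radon p A = {\<mu> \<in> borel_measures. tight_rel A \<mu> \<and> locally_p_finite p A \<mu>}"

lemma sets_radon: "\<mu> \<in> radon p A \<Longrightarrow> sets \<mu> = sets borel"
  by (simp add: radon_def borel_measures_def)

lemma radon_cong: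
  assumes "closed A" "(\<mu>, \<nu>) \<in> rel_eq A" "\<mu> \<in> radon p A"
  shows "\<nu> \<in> radon p A"
proof -
  have S: "sets \<mu> = sets borel" "sets \<nu> = sets borel"
    and eq: "\<And>E. E \<in> sets borel \<Longrightarrow> E \<subseteq> - A \<Longrightarrow> emeasure \<mu> E = emeasure \<nu> E"
    using assms by (auto simp: rel_eq_iff borel_measures_def)
  have "tight_rel A \<nu>"
    using tight_rel_cong[OF eq] assms(3) by (simp add: radon_def)
  moreover have "locally_p_finite p A \<nu>"
    using assms(3) locally_p_finite_mono[OF assms(1) S(2,1)] eq by (simp add: radon_def)
  ultimately show ?thesis
    using S by (simp add: radon_def borel_measures_def)
qed

text \<open>Membership in \<open>rel_radon\<close> asks for all representatives of a class; by
  \<open>radon_cong\<close> a single one decides.\<close>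

lemma rel_radon_eq_image:
  assumes "closed A"
  shows "rel_radon p A = (\<lambda>\<mu>. rel_eq A `` {\<mu>}) ` radon p A"
proof (intro equalityI subsetI)
  fix P assume P: "P \<in> rel_radon p A"
  then obtain \<mu> where "\<mu> \<in> borel_measures" "P = rel_eq A `` {\<mu>}"
    by (auto simp: rel_radon_def rel_borel_measures_def elim: quotientE)
  moreover from this have "\<mu> \<in> P"
    using equiv_class_self[OF equiv_rel_eq[OF assms]] by blast
  ultimately show "P \<in> (\<lambda>\<mu>. rel_eq A `` {\<mu>}) ` radon p A"
    using P by (auto simp: rel_radon_def radon_def)
next
  fix P assume "P \<in> (\<lambda>\<mu>. rel_eq A `` {\<mu>}) ` radon p A"
  then obtain \<mu> where \<mu>: "\<mu> \<in> radon p A" "P = rel_eq A `` {\<mu>}" by blast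
  then have "\<nu> \<in> radon p A" if "\<nu> \<in> P" for \<nu>
    using radon_cong[OF assms] that by blast
  then show "P \<in> rel_radon p A"
    using \<mu> by (auto simp: rel_radon_def rel_borel_measures_def radon_def intro!: quotientI)
qed

lemma rel_class_in_rel_radon: "closed A \<Longrightarrow> \<mu> \<in> radon p A \<Longrightarrow> rel_eq A `` {\<mu>} \<in> rel_radon p A"
  by (simp add: rel_radon_eq_image)

lemma rel_radonE:
  assumes "P \<in> rel_radon p A" "closed A"
  obtains \<mu> where "\<mu> \<in> radon p A" "P = rel_eq A `` {\<mu>}"
  using assms by (auto simp: rel_radon_eq_image)

lemma rel_class_eq_iff:
  assumes "closed A" "sets \<mu> = sets borel" "sets \<nu> = sets borel"
  shows "rel_eq A `` {\<mu>} = rel_eq A `` {\<nu>} \<longleftrightarrow>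
    (\<forall>E\<in>sets borel. E \<subseteq> - A \<longrightarrow> emeasure \<mu> E = emeasure \<nu> E)"
  using assms
  by (subst eq_equiv_class_iff[OF equiv_rel_eq[OF assms(1)]]) (auto simp: rel_eq_iff borel_measures_def)

text \<open>All pairs of representatives contribute the same class to the union defining
  \<open>rel_add\<close>, and at least one pair exists, so the union collapses to that
  class.\<close>

lemma rel_add_class:
  assumes A: "closed A" and S: "sets \<mu> = sets borel" "sets \<nu> = sets borel"
  shows "rel_add A (rel_eq A `` {\<mu>}) (rel_eq A `` {\<nu>}) = rel_eq A `` {add_measure \<mu> \<nu>}"
proof -
  have "rel_eq A `` {add_measure \<mu>' \<nu>'} = rel_eq A `` {add_measure \<mu> \<nu>}"
    if "\<mu>' \<in> rel_eq A `` {\<mu>}" "\<nu>' \<in> rel_eq A `` {\<nu>}" for \<mu>' \<nu>'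
    using that A S by (subst rel_class_eq_iff[OF A]) (auto simp: rel_eq_iff borel_measures_def emeasure_add_measure)
  moreover have "\<mu> \<in> rel_eq A `` {\<mu>}" "\<nu> \<in> rel_eq A `` {\<nu>}"
    using S equiv_class_self[OF equiv_rel_eq[OF A]] by (auto simp: borel_measures_def)
  ultimately show ?thesis
    unfolding rel_add_def by blast
qed

lemma rel_scale_class:
  assumes A: "closed A" and S: "sets \<mu> = sets borel"
  shows "rel_scale A a (rel_eq A `` {\<mu>}) = rel_eq A `` {scale_measure (ennreal a) \<mu>}"
proof -
  have "rel_eq A `` {scale_measure (ennreal a) \<mu>'} = rel_eq A `` {scale_measure (ennreal a) \<mu>}"
    if "\<mu>' \<in> rel_eq A `` {\<mu>}" for \<mu>'
    using that A S by (subst rel_class_eq_iff[OF A]) (auto simp: rel_eq_iff borel_measures_def)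
  moreover have "\<mu> \<in> rel_eq A `` {\<mu>}"
    using S equiv_class_self[OF equiv_rel_eq[OF A]] by (auto simp: borel_measures_def)
  ultimately show ?thesis
    unfolding rel_scale_def by blast
qed

section \<open>Closure properties of relative Radon measures\<close>

lemma radon_add:
  "closed A \<Longrightarrow> \<mu> \<in> radon p A \<Longrightarrow> \<nu> \<in> radon p A \<Longrightarrow> add_measure \<mu> \<nu> \<in> radon p A"
  by (simp add: radon_def borel_measures_def tight_rel_add locally_p_finite_add)

lemma radon_scale:
  "closed A \<Longrightarrow> \<mu> \<in> radon p A \<Longrightarrow> scale_measure (ennreal a) \<mu> \<in> radon p A"
  by (simp add: radon_def borel_measures_def tight_rel_scale locally_p_finite_scale)

lemma radon_null:
  fixes A :: "'a::metric_space set"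
  shows "null_measure borel \<in> radon p A"
proof -
  have "measure_restr (null_measure borel) UNIV = (null_measure borel :: 'a measure)"
    by (rule measure_eqI) (simp_all add: emeasure_measure_restr)
  moreover have "p_finite p A (null_measure borel)"
    unfolding p_finite_def by (simp add: gt_ex)
  ultimately have "locally_p_finite p A (null_measure borel)"
    unfolding locally_p_finite_def by (intro allI bexI[of _ UNIV]) simp_all
  moreover have "tight_rel A (null_measure borel)"
    by (rule tight_relI) simp_all
  ultimately show ?thesis
    by (simp add: radon_def borel_measures_def)
qed

text \<open>Local p-finiteness is inherited from \<mu> + \<nu>, which dominates the join
  setwise.\<close>

lemma radon_sup_measure':
  assumes A: "closed A" and \<mu>: "\<mu> \<in> radon p A" and \<nu>: "\<nu> \<in> radon p A"
  shows "sup_measure' \<mu> \<nu> \<in> radon p A"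
proof -
  have S: "sets \<mu> = sets borel" "sets \<nu> = sets borel"
    using \<mu> \<nu> by (auto dest: sets_radon)
  have "emeasure (sup_measure' \<mu> \<nu>) E \<le> emeasure (add_measure \<mu> \<nu>) E" if "E \<in> sets borel" for E
    using S that by (intro emeasure_sup_measure'_le2) (auto simp: emeasure_add_measure)
  then have "locally_p_finite p A (sup_measure' \<mu> \<nu>)"
    by (rule locally_p_finite_mono[OF A, of _ "add_measure \<mu> \<nu>", rotated 2])
      (use radon_add[OF A \<mu> \<nu>] S in \<open>auto simp: radon_def\<close>)
  then show ?thesis
    using tight_rel_sup_measure'[OF S] \<mu> \<nu> S by (simp add: radon_def borel_measures_def)
qed

lemma radon_compact:
  assumes "closed A" "A \<noteq> {}" "\<mu> \<in> radon p A" "compact K" "K \<subseteq> - A"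
  shows "emeasure \<mu> K < \<infinity>"
  using assms by (intro locally_p_finite_compact) (auto simp: radon_def borel_measures_def)

lemma radon_eqI:
  assumes "\<mu> \<in> radon p A" "\<nu> \<in> radon p A"
    and "\<And>K. compact K \<Longrightarrow> K \<subseteq> - A \<Longrightarrow> emeasure \<mu> K = emeasure \<nu> K"
    and E: "E \<in> sets borel" "E \<subseteq> - A"
  shows "emeasure \<mu> E = emeasure \<nu> E"
proof -
  have "(SUP K\<in>{K. compact K \<and> K \<subseteq> E}. emeasure \<mu> K) = (SUP K\<in>{K. compact K \<and> K \<subseteq> E}. emeasure \<nu> K)"
    using E by (intro SUP_cong refl assms(3)) auto
  then show ?thesis
    using assms(1,2) tight_relD[of A, OF _ E] by (simp add: radon_def)
qed

text \<open>The difference must itself be Radon for the setwise order to agree with the natural one.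
  It is tight because \<nu> is, by an estimate on sets of finite measure, and locally p-finite
  because it is at most \<nu> off \<open>A\<close>.\<close>

lemma radon_diff:
  assumes A: "closed A" "A \<noteq> {}" and \<mu>: "\<mu> \<in> radon p A" and \<nu>: "\<nu> \<in> radon p A"
    and le: "\<And>E. E \<in> sets borel \<Longrightarrow> E \<subseteq> - A \<Longrightarrow> emeasure \<mu> E \<le> emeasure \<nu> E"
  obtains \<zeta> where "\<zeta> \<in> radon p A"
    and "\<And>E. E \<in> sets borel \<Longrightarrow> E \<subseteq> - A \<Longrightarrow> emeasure \<mu> E + emeasure \<zeta> E = emeasure \<nu> E"
proof -
  have S: "sets \<mu> = sets borel" "sets \<nu> = sets borel"
    using \<mu> \<nu> by (auto dest: sets_radon)
  have A': "- A \<in> sets borel" using A by (auto intro: borel_open)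
  \<comment> \<open>The hypothesis compares \<mu> and \<nu> only off \<open>A\<close>; cutting both
    down to \<open>- A\<close> gives domination on every Borel set, as the subtraction
    requires.\<close>
  define m n where "m = measure_restr \<mu> (- A)" and "n = measure_restr \<nu> (- A)"
  have Smn: "sets m = sets borel" "sets n = sets borel"
    using S by (auto simp: m_def n_def)
  have emn: "emeasure m E = emeasure \<mu> (E \<inter> - A)" "emeasure n E = emeasure \<nu> (E \<inter> - A)"
    if "E \<in> sets borel" for E
    using that S A' by (auto simp: m_def n_def emeasure_measure_restr)
  have lemn: "emeasure m E \<le> emeasure n E" if "E \<in> sets n" for E
    using that A' Smn by (auto simp: emn intro!: le)
  let ?I = "{F \<in> sets n. emeasure n F < \<infinity>}"
  let ?\<zeta> = "diff_measure_fin n m"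
  have T: "tight_rel A \<nu>" using \<nu> by (simp add: radon_def)
  have sum: "emeasure \<mu> E + emeasure ?\<zeta> E = emeasure \<nu> E" if E: "E \<in> sets borel" "E \<subseteq> - A" for E
  proof -
    have [simp]: "E \<inter> - A = E" using E by auto
    \<comment> \<open>Semifiniteness of \<open>n\<close>: a compact subset of \<open>E\<close> has
      finite measure, hence is itself an admissible \<open>F\<close>, and by tightness such sets
      exhaust \<nu>(E).\<close>
    have "emeasure \<nu> K \<le> (SUP F\<in>?I. emeasure n (F \<inter> E))" if K: "compact K" "K \<subseteq> E" for K
    proof (rule SUP_upper2)
      have KE: "K \<inter> - A = K" "K \<inter> E = K" "K \<in> sets borel" using K E by (auto intro: borel_compact)
      then show "K \<in> ?I"
        using K E Smn radon_compact[OF A \<nu>, of K] by (auto simp: emn)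
      show "emeasure \<nu> K \<le> emeasure n (K \<inter> E)"
        using KE by (simp add: emn)
    qed
    then have "emeasure n E \<le> (SUP F\<in>?I. emeasure n (F \<inter> E))"
      unfolding emn(2)[OF E(1)] \<open>E \<inter> - A = E\<close> tight_relD[OF T E] by (auto intro!: SUP_least)
    then have "emeasure m E + emeasure ?\<zeta> E = emeasure n E"
      using E Smn lemn by (intro emeasure_add_diff_measure_fin) auto
    then show ?thesis using E by (simp add: emn)
  qed
  have S\<zeta>: "sets ?\<zeta> = sets borel" using Smn by simp
  have "tight_rel A ?\<zeta>"
  proof (rule tight_relI[OF S\<zeta>])
    fix E :: "'a set" assume E: "E \<in> sets borel" "E \<subseteq> - A"
    let ?c = "SUP K\<in>{K. compact K \<and> K \<subseteq> E}. emeasure ?\<zeta> K"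
    have "emeasure n (F \<inter> E) - emeasure m (F \<inter> E) \<le> ?c" if F: "F \<in> ?I" for F
    proof -
      have FE: "F \<inter> E \<in> sets borel" "F \<inter> E \<subseteq> - A" "F \<inter> E \<inter> - A = F \<inter> E"
        using F E Smn by auto
      have "emeasure n (F \<inter> E) \<le> emeasure n F"
        using F by (intro emeasure_mono) auto
      then have fin: "emeasure n (F \<inter> E) < top"
        using F by (auto intro: le_less_trans)
      \<comment> \<open>Bounding \<mu>(K) by the fixed value \<mu>(F \<inter> E) frees the estimate
        of \<open>K\<close>. Taking the supremum over \<open>K\<close> gives \<nu>(F \<inter> E)
        \<le> \<mu>(F \<inter> E) + \<open>?c\<close>, and \<open>fin\<close> then permits
        subtracting \<mu>(F \<inter> E), since it excludes \<open>top - top\<close>.\<close>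
      have "emeasure \<nu> K \<le> emeasure \<mu> (F \<inter> E) + ?c" if K: "compact K" "K \<subseteq> F \<inter> E" for K
      proof -
        have "emeasure \<nu> K = emeasure \<mu> K + emeasure ?\<zeta> K"
          using K E by (intro sum[symmetric]) (auto intro: borel_compact)
        also have "\<dots> \<le> emeasure \<mu> (F \<inter> E) + ?c"
          using K FE S by (intro add_mono emeasure_mono SUP_upper) auto
        finally show ?thesis .
      qed
      then have "emeasure \<nu> (F \<inter> E) \<le> emeasure \<mu> (F \<inter> E) + ?c"
        unfolding tight_relD[OF T FE(1,2)] by (auto intro!: SUP_least)
      then show ?thesis
        using fin FE by (auto simp: ennreal_minus_le_iff emn)
    qed
    then show "emeasure ?\<zeta> E \<le> ?c"
      using E Smn lemn by (subst emeasure_diff_measure_fin) (auto intro!: SUP_least)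
  qed
  moreover have "locally_p_finite p A ?\<zeta>"
  proof (rule locally_p_finite_mono[OF A(1) S\<zeta> S(2)])
    show "emeasure ?\<zeta> E \<le> emeasure \<nu> E" if "E \<in> sets borel" "E \<subseteq> - A" for E
      by (simp add: sum[OF that, symmetric])
    show "locally_p_finite p A \<nu>" using \<nu> by (simp add: radon_def)
  qed
  ultimately have "?\<zeta> \<in> radon p A"
    using S\<zeta> by (simp add: radon_def borel_measures_def)
  then show ?thesis
    using sum that by blast
qed

section \<open>The order and the cone structure on classes\<close>

lemma natural_le_rel_radon_iff:
  assumes A: "closed A" "A \<noteq> {}" and \<mu>: "\<mu> \<in> radon p A" and \<nu>: "\<nu> \<in> radon p A"
  shows "natural_le (rel_radon p A) (rel_add A) (rel_eq A `` {\<mu>}) (rel_eq A `` {\<nu>}) \<longleftrightarrow>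
    (\<forall>E\<in>sets borel. E \<subseteq> - A \<longrightarrow> emeasure \<mu> E \<le> emeasure \<nu> E)" (is "?L \<longleftrightarrow> ?R")
proof -
  have S: "sets \<mu> = sets borel" "sets \<nu> = sets borel"
    using \<mu> \<nu> by (auto dest: sets_radon)
  have add: "rel_add A (rel_eq A `` {\<mu>}) (rel_eq A `` {\<zeta>}) = rel_eq A `` {\<nu>} \<longleftrightarrow>
      (\<forall>E\<in>sets borel. E \<subseteq> - A \<longrightarrow> emeasure \<mu> E + emeasure \<zeta> E = emeasure \<nu> E)" if "\<zeta> \<in> radon p A" for \<zeta>
    using that S sets_radon[OF that] A
    by (simp add: rel_add_class rel_class_eq_iff emeasure_add_measure)
  have "?L \<longleftrightarrow> (\<exists>\<zeta>\<in>radon p A. \<forall>E\<in>sets borel. E \<subseteq> - A \<longrightarrow> emeasure \<mu> E + emeasure \<zeta> E = emeasure \<nu> E)"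
    unfolding natural_le_def rel_radon_eq_image[OF A(1)] using add by auto
  also have "\<dots> \<longleftrightarrow> ?R"
  proof
    assume "\<exists>\<zeta>\<in>radon p A. \<forall>E\<in>sets borel. E \<subseteq> - A \<longrightarrow> emeasure \<mu> E + emeasure \<zeta> E = emeasure \<nu> E"
    then show ?R by (metis le_iff_add)
  next
    assume ?R
    then show "\<exists>\<zeta>\<in>radon p A. \<forall>E\<in>sets borel. E \<subseteq> - A \<longrightarrow> emeasure \<mu> E + emeasure \<zeta> E = emeasure \<nu> E"
      using radon_diff[OF A \<mu> \<nu>] by metis
  qed
  finally show ?thesis .
qed

lemma abstract_convex_cone_rel_radon:
  assumes A: "closed A"
  shows "abstract_convex_cone (rel_radon p A) (rel_add A) (rel_zero A) (rel_scale A)"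
  by unfold_locales
    \<comment> \<open>On representatives each axiom is an identity between values in
      \<open>ennreal\<close>. The elimination is optional because the closure axiom for zero
      mentions no class.\<close>
    ((elim rel_radonE[OF _ A])?,
      simp add: A rel_zero_def rel_add_class rel_scale_class sets_radon[of _ p] radon_add radon_scale
        radon_null rel_class_in_rel_radon rel_class_eq_iff emeasure_add_measure add_ac mult.assoc
        distrib_left distrib_right ennreal_mult ennreal_plus)+

lemma cancellative_on_rel_radon:
  assumes A: "closed A" "A \<noteq> {}"
  shows "cancellative_on (rel_radon p A) (rel_add A)"
  unfolding cancellative_on_def
proof (intro ballI impI, elim rel_radonE[OF _ A(1)], hypsubst)
  fix \<mu> \<nu> \<zeta> assume R: "\<mu> \<in> radon p A" "\<nu> \<in> radon p A" "\<zeta> \<in> radon p A"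
    and eq: "rel_add A (rel_eq A `` {\<mu>}) (rel_eq A `` {\<zeta>}) = rel_add A (rel_eq A `` {\<nu>}) (rel_eq A `` {\<zeta>})"
  note S = R[THEN sets_radon]
  have sum: "emeasure \<mu> E + emeasure \<zeta> E = emeasure \<nu> E + emeasure \<zeta> E"
    if "E \<in> sets borel" "E \<subseteq> - A" for E
    using eq that A S by (simp add: rel_add_class rel_class_eq_iff emeasure_add_measure)
  \<comment> \<open>Infinite values do not cancel, so cancellation is done on compact sets, where
    \<zeta> is finite.\<close>
  have "emeasure \<mu> K = emeasure \<nu> K" if K: "compact K" "K \<subseteq> - A" for K
    using sum[OF borel_compact[OF K(1)] K(2)] radon_compact[OF A R(3) K]
    by (auto simp: ennreal_add_left_cancel add.commute[of _ "emeasure \<zeta> K"])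
  then have "\<forall>E\<in>sets borel. E \<subseteq> - A \<longrightarrow> emeasure \<mu> E = emeasure \<nu> E"
    using radon_eqI[OF R(1,2)] by blast
  then show "rel_eq A `` {\<mu>} = rel_eq A `` {\<nu>}"
    by (simp add: rel_class_eq_iff[OF A(1) S(1,2)])
qed

lemma zero_sum_free_on_rel_radon:
  assumes A: "closed A"
  shows "zero_sum_free_on (rel_radon p A) (rel_add A) (rel_zero A)"
  unfolding zero_sum_free_on_def
  by (intro ballI impI, elim rel_radonE[OF _ A])
    (simp add: A rel_zero_def rel_add_class rel_class_eq_iff sets_radon[of _ p] emeasure_add_measure)

lemma join_rel_radon:
  assumes A: "closed A" "A \<noteq> {}" and P: "P \<in> rel_radon p A" and Q: "Q \<in> rel_radon p A"
  shows "\<exists>R. is_join (rel_radon p A) (natural_le (rel_radon p A) (rel_add A)) P Q R"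
proof -
  obtain \<mu> \<nu> where \<mu>: "\<mu> \<in> radon p A" "P = rel_eq A `` {\<mu>}" and \<nu>: "\<nu> \<in> radon p A" "Q = rel_eq A `` {\<nu>}"
    using P Q A(1) by (meson rel_radonE)
  note S = sets_radon[OF \<mu>(1)] sets_radon[OF \<nu>(1)]
  note s = radon_sup_measure'[OF A(1) \<mu>(1) \<nu>(1)]
  \<comment> \<open>An upper bound \<rho> dominates only off \<open>A\<close>. This suffices because
    bounding the join at \<open>E\<close> involves only Borel subsets of \<open>E\<close>.\<close>
  have "emeasure (sup_measure' \<mu> \<nu>) E \<le> emeasure \<rho> E"
    if "\<rho> \<in> radon p A" "E \<in> sets borel" "E \<subseteq> - A"
      "\<forall>E\<in>sets borel. E \<subseteq> - A \<longrightarrow> emeasure \<mu> E \<le> emeasure \<rho> E"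
      "\<forall>E\<in>sets borel. E \<subseteq> - A \<longrightarrow> emeasure \<nu> E \<le> emeasure \<rho> E" for \<rho> E
    using that S sets_radon[OF that(1)] by (intro emeasure_sup_measure'_le2) auto
  then have "is_join (rel_radon p A) (natural_le (rel_radon p A) (rel_add A)) P Q
      (rel_eq A `` {sup_measure' \<mu> \<nu>})"
    unfolding is_join_def \<mu>(2) \<nu>(2)
  proof (intro conjI ballI impI; (elim conjE rel_radonE[OF _ A(1)])?)
    show "rel_eq A `` {sup_measure' \<mu> \<nu>} \<in> rel_radon p A"
      using A(1) s by (rule rel_class_in_rel_radon)
  qed (use s \<mu>(1) \<nu>(1) S in \<open>auto simp: natural_le_rel_radon_iff[OF A]
        intro: le_emeasure_sup_measure'1 le_emeasure_sup_measure'2\<close>)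
  then show ?thesis ..
qed

theorem proposition4p14:
  fixes A :: "'a::metric_space set" and p :: ennreal
  assumes "closed A" and "A \<noteq> {}"
  shows "riesz_cone (rel_radon p A) (rel_add A) (rel_zero A) (rel_scale A) \<and>
    zero_sum_free_on (rel_radon p A) (rel_add A) (rel_zero A)"
  using assms
  by (intro conjI riesz_coneI abstract_convex_cone_rel_radon cancellative_on_rel_radon
      zero_sum_free_on_rel_radon join_rel_radon)

end
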